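(* (a) Suppose that for every integer $N\ge 1$ there exists an integer $k\ge 1$ such that $T^k(N)=1$. Then for every $n\in\mathbb{Z}$ and every integer $P\ge 2n+2$ there exists an integer $m\ge 1$ such that $F_n^m(P)=2n+2$. (b) Conversely, let $n\in\mathbb{Z}$ and suppose that for every integer $P\ge 2n+2$ there exists an integer $m\ge 1$ such that $F_n^m(P)=2n+2$. Then for every integer $N\ge 1$ there exists an integer $k\ge 1$ such that $T^k(N)=1$.
   Context: The Collatz function $T$ is defined on positive integers by $T(N)=\frac{N}{2}$ if $N$ is even and $T(N)=\frac{3}{2}N+\frac12$ if $N$ is odd. For $n\in\mathbb{Z}$, put $D(n)=\{P\in\mathbb{Z} : P\ge 2n+2\}$. The function $F_n$ is defined on $D(n)$, with integer values, by $F_n(P)=\frac{3}{2}P-n$ if $P$ is even, and $F_n(P)=\frac{P}{2}+\frac{2n+1}{2}$ if $P$ is odd (the formula makes sense for every integer $P$, and iterates are computed by applying it repeatedly). $T^k$ and $F_n^m$ denote the $k$-fold and $m$-fold iterates. *)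

theory Defs
  imports Complex_Main
begin

(* The divisions by 2 in both definitions are exact, so div loses nothing: see the lemmas below.
   Both maps are given by their formulas on all of int; the domains (N >= 1 for collatz_T,
   P >= 2n+2 for F n) are mapped to themselves and are imposed where the maps are used. *)

definition collatz_T :: "int \<Rightarrow> int" where
  "collatz_T N = (if even N then N div 2 else (3 * N + 1) div 2)"

definition F :: "int \<Rightarrow> int \<Rightarrow> int" where
  "F n P = (if even P then (3 * P) div 2 - n else (P + (2 * n + 1)) div 2)"

lemma collatz_T_exact:
  "real_of_int (collatz_T N) = (if even N then N / 2 else 3 / 2 * N + 1 / 2)"
proof (cases "even N")
  case True
  then obtain q where "N = 2 * q" by (rule evenE)
  then show ?thesis by (simp add: collatz_T_def)
next
  case False
  then obtain q where q: "N = 2 * q + 1" by (rule oddE)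
  have "(3 * N + 1) div 2 = 3 * q + 2" unfolding q by presburger
  with False show ?thesis by (simp add: collatz_T_def q field_simps)
qed

lemma F_exact:
  "real_of_int (F n P) = (if even P then 3 / 2 * P - n else P / 2 + (2 * n + 1) / 2)"
proof (cases "even P")
  case True
  then obtain q where "P = 2 * q" by (rule evenE)
  then show ?thesis by (simp add: F_def)
next
  case False
  then obtain q where q: "P = 2 * q + 1" by (rule oddE)
  have "(P + (2 * n + 1)) div 2 = q + n + 1" unfolding q by presburger
  with False show ?thesis by (simp add: F_def q field_simps)
qed

lemma collatz_T_ge_1: "N \<ge> 1 \<Longrightarrow> collatz_T N \<ge> 1"
  unfolding collatz_T_def by presburger

lemma F_ge: "P \<ge> 2 * n + 2 \<Longrightarrow> F n P \<ge> 2 * n + 2"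
  unfolding F_def by presburger

end

theory Submission
  imports Defs
begin

text \<open>Since \<open>2 * n + 1\<close> is odd, the shift by it pairs the halving branch of
  \<open>collatz_T\<close> with the odd branch of \<open>F n\<close>, and the tripling branch with
  the even one; \<open>F_translate\<close> checks that they match. Orbits then correspond step by
  step, so each target is reached after the same number of steps
  (\<open>funpow_F_eq_iff\<close>).\<close>

text \<open>The translation by 2n + 1 swaps parities and conjugates the Collatz map to F n, sending the
  domain N \<ge> 1 to P \<ge> 2n + 2 and the target 1 to 2n + 2.\<close>

lemma F_translate: "F n (N + (2 * n + 1)) = collatz_T N + (2 * n + 1)"
  unfolding F_def collatz_T_def by presburger

lemma funpow_F_translate: "(F n ^^ m) (N + (2 * n + 1)) = (collatz_T ^^ m) N + (2 * n + 1)"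
  \<comment> \<open>The restricted simp set leaves the sum in the shape that
    \<open>F_translate\<close> rewrites.\<close>
  by (induction m) (simp_all only: funpow.simps id_apply comp_apply F_translate)

lemma funpow_F_eq_iff: "(F n ^^ m) P = 2 * n + 2 \<longleftrightarrow> (collatz_T ^^ m) (P - (2 * n + 1)) = 1"
  using funpow_F_translate[of m n "P - (2 * n + 1)"] by simp

text \<open>The shift is a bijection between the two domains. As \<open>n\<close> is fixed but
  arbitrary, (a) follows for all \<open>n\<close> and (b) from any single one.\<close>

lemma F_reaches_iff_collatz_reaches:
  "(\<forall>P \<ge> 2 * n + 2. \<exists>m \<ge> 1. (F n ^^ m) P = 2 * n + 2) \<longleftrightarrow>
   (\<forall>N \<ge> 1. \<exists>k \<ge> 1. (collatz_T ^^ k) N = 1)" (is "?L \<longleftrightarrow> ?R")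
proof
  assume L: ?L
  show ?R
  proof (intro allI impI)
    fix N :: int
    assume "N \<ge> 1"
    then show "\<exists>k \<ge> 1. (collatz_T ^^ k) N = 1"
      using L[rule_format, of "N + (2 * n + 1)"] by (simp add: funpow_F_eq_iff)
  qed
next
  assume R: ?R
  show ?L
  proof (intro allI impI)
    fix P :: int
    assume "P \<ge> 2 * n + 2"
    then show "\<exists>m \<ge> 1. (F n ^^ m) P = 2 * n + 2"
      using R[rule_format, of "P - (2 * n + 1)"] by (simp add: funpow_F_eq_iff)
  qed
qed

theorem theorem2p3:
  "((\<forall>N::int. N \<ge> 1 \<longrightarrow> (\<exists>k::nat. k \<ge> 1 \<and> (collatz_T ^^ k) N = 1)) \<longrightarrow>
      (\<forall>n P::int. P \<ge> 2 * n + 2 \<longrightarrow> (\<exists>m::nat. m \<ge> 1 \<and> (F n ^^ m) P = 2 * n + 2)))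
   \<and>
   (\<forall>n::int. (\<forall>P::int. P \<ge> 2 * n + 2 \<longrightarrow> (\<exists>m::nat. m \<ge> 1 \<and> (F n ^^ m) P = 2 * n + 2)) \<longrightarrow>
      (\<forall>N::int. N \<ge> 1 \<longrightarrow> (\<exists>k::nat. k \<ge> 1 \<and> (collatz_T ^^ k) N = 1)))"
  using F_reaches_iff_collatz_reaches by blast

end
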